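(* There is no algorithm $\mathcal{A}$ (in the exploration model described in the context) together with a natural number $n$ such that $\mathcal{A}$ successfully explores all finite connected bipartite graphs and $\mathcal{A}$ uses strictly fewer than $n-2$ colors on every graph with $n$ vertices.
   Context: Exploration model. Graphs are finite, simple, undirected and connected; vertices are anonymous and edges carry no port labels. Each vertex carries a color in $\mathbb{N}=\{0,1,2,\dots\}$, where $0$ means "uncolored"; initially all vertices have color $0$. An algorithm is a function $\mathrm{move}$ mapping every environment $(c_0,E)$ — where $c_0\in\mathbb{N}$ is the color of the agent's current vertex and $E:\mathbb{N}\to\mathbb{N}$ (zero almost everywhere) gives, for each color $c$, the number $E(c)$ of neighbors of the current vertex having color $c$ — either to $\mathrm{Stop}$ or to a pair $(c_1,d)\in\mathbb{N}\times\mathbb{N}$ with $E(d)>0$, subject to $c_1=c_0$ whenever $c_0\neq 0$ (a vertex may only be colored while it is uncolored). A run on a graph $G$: an adversary chooses a start vertex $v_0$ and places the agent there; in each step, with the agent at $v$, $\mathrm{move}$ is evaluated at the environment of $v$; if the value is $\mathrm{Stop}$ the run ends, and if it is $(c_1,d)$ then $v$ receives color $c_1$ and the adversary chooses an arbitrary neighbor of $v$ of color $d$, to which the agent moves. The agent has no other memory. A vertex is visited if the agent is located at it in some step. An algorithm successfully explores $G$ if for every adversary (every choice of start vertex and of neighbors), after finitely many steps all vertices have been visited, the agent is at $v_0$, and the decision is $\mathrm{Stop}$. The number of colors used in a run is the number of distinct nonzero colors assigned during the run; $\mathcal{A}$ uses fewer than $m$ colors on $G$ if every run of $\mathcal{A}$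 on $G$ (for every adversary) uses fewer than $m$ colors. *)

theory Defs
  imports "Graph_Theory.Digraph_Component"
begin

text \<open>
  A simple undirected graph is a \<^locale>\<open>pair_graph\<close> (finite, loop-free, symmetric, without
  parallel arcs): an edge is a pair of opposite arcs.  Note that \<^const>\<open>connected\<close> excludes
  the graph without vertices.
\<close>

definition connected_graph :: "'v pair_pre_digraph \<Rightarrow> bool" where
  "connected_graph G \<longleftrightarrow> pair_graph G \<and> connected (with_proj G)"

definition bipartite :: "'v pair_pre_digraph \<Rightarrow> bool" where
  "bipartite G \<longleftrightarrow> (\<exists>U W. pverts G = U \<union> W \<and> U \<inter> W = {} \<and>
     (\<forall>(u, v) \<in> parcs G. (u \<in> U \<and> v \<in> W) \<or> (u \<in> W \<and> v \<in> U)))"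

datatype decision = Stop | Move nat nat

text \<open>
  An environment is the colour of the current vertex (0 = uncoloured) together with the function
  counting the neighbours of each colour.  Only environments of finite support are legitimate
  arguments; the value of an algorithm elsewhere is irrelevant.  In \<open>Move c1 d\<close>, \<open>c1\<close> is the
  colour given to the current vertex and \<open>d\<close> the colour of the neighbour to move to.
\<close>

type_synonym algorithm = "nat \<Rightarrow> (nat \<Rightarrow> nat) \<Rightarrow> decision"

definition is_algorithm :: "algorithm \<Rightarrow> bool" where
  "is_algorithm mv \<longleftrightarrow>
     (\<forall>c0 E c1 d. finite {c. E c \<noteq> 0} \<and> mv c0 E = Move c1 d \<longrightarrow>
        E d > 0 \<and> (c0 \<noteq> 0 \<longrightarrow> c1 = c0))"

text \<open>A state consists of the current colouring and the position of the agent.\<close>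

type_synonym 'v state = "('v \<Rightarrow> nat) \<times> 'v"

definition env :: "'v pair_pre_digraph \<Rightarrow> 'v state \<Rightarrow> nat \<Rightarrow> nat" where
  "env G s c = card {w. (snd s, w) \<in> parcs G \<and> fst s w = c}"

definition decide :: "algorithm \<Rightarrow> 'v pair_pre_digraph \<Rightarrow> 'v state \<Rightarrow> decision" where
  "decide mv G s = mv (fst s (snd s)) (env G s)"

definition step :: "algorithm \<Rightarrow> 'v pair_pre_digraph \<Rightarrow> 'v state \<Rightarrow> 'v state \<Rightarrow> bool" where
  "step mv G s s' \<longleftrightarrow>
     (\<exists>c1 d. decide mv G s = Move c1 d \<and> fst s' = (fst s)(snd s := c1) \<and>
        (snd s, snd s') \<in> parcs G \<and> fst s (snd s') = d)"

text \<open>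
  The runs are exactly the outcomes of all adversaries.  A run that ends is represented as an
  infinite sequence by repeating its final state, at which the decision is \<^const>\<open>Stop\<close>.  As an
  algorithm only chooses colours present in the neighbourhood, a run never gets stuck otherwise.
\<close>

definition is_run :: "algorithm \<Rightarrow> 'v pair_pre_digraph \<Rightarrow> (nat \<Rightarrow> 'v state) \<Rightarrow> bool" where
  "is_run mv G r \<longleftrightarrow>
     fst (r 0) = (\<lambda>_. 0) \<and> snd (r 0) \<in> pverts G \<and>
     (\<forall>t. if decide mv G (r t) = Stop then r (Suc t) = r t else step mv G (r t) (r (Suc t)))"

definition explores :: "algorithm \<Rightarrow> 'v pair_pre_digraph \<Rightarrow> bool" where
  "explores mv G \<longleftrightarrow>
     (\<forall>r. is_run mv G r \<longrightarrow>
        (\<exists>t. (\<forall>v \<in> pverts G. \<exists>i\<le>t. snd (r i) = v) \<and>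
             snd (r t) = snd (r 0) \<and> decide mv G (r t) = Stop))"

definition colors_used :: "algorithm \<Rightarrow> 'v pair_pre_digraph \<Rightarrow> (nat \<Rightarrow> 'v state) \<Rightarrow> nat set" where
  "colors_used mv G r = {c. c \<noteq> 0 \<and> (\<exists>t d. decide mv G (r t) = Move c d)}"

text \<open>The bound is an integer, so that \<open>n - 2\<close> is not truncated for small \<open>n\<close>.\<close>

definition uses_fewer_colors :: "algorithm \<Rightarrow> 'v pair_pre_digraph \<Rightarrow> int \<Rightarrow> bool" where
  "uses_fewer_colors mv G m \<longleftrightarrow>
     (\<forall>r. is_run mv G r \<longrightarrow>
        finite (colors_used mv G r) \<and> int (card (colors_used mv G r)) < m)"

end

(* An algorithm that explores all bipartite graphs must, when it walks along a path whose vertices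
have one further uncoloured neighbour each, colour every new vertex at once and later move on to the
next one; otherwise the adversary hides part of a suitable bipartite graph from it.  Since a new
vertex only sees the colour of its predecessor, the colours on the path are the iterates of a fixed
function.  If two vertices at even distance had the same colour, an uncoloured vertex x could be
attached to both of them in a bipartite graph, and from x the adversary always moves to the
earlier one.  Everything around that vertex is coloured by then, so the agent always leaves it in the
same way and is confined to one side of the path for ever.  A repetition at odd distance makes the
colours periodic and hence causes one at even distance, so all colours on the path are distinct.
Finally, in a path on n - 1 vertices together with one vertex adjacent to all of them, the first
n - 2 path vertices look the same as in the bipartite graphs. *)

theory Submission
  imports Defs
begin

section \<open>Runs and adversaries\<close>

definition nbrs :: "'v pair_pre_digraph \<Rightarrow> 'v \<Rightarrow> 'v set" where
  "nbrs G v = {w. (v, w) \<in> parcs G}"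

lemma finite_nbrs: "finite (parcs G) \<Longrightarrow> finite (nbrs G v)"
  unfolding nbrs_def by (rule finite_subset[of _ "snd ` parcs G"]) force+

lemma env_eq_sum:
  assumes "finite (nbrs G v)"
  shows "env G (f, v) d = (\<Sum>w\<in>nbrs G v. of_bool (f w = d))"
proof -
  have "{w. (v, w) \<in> parcs G \<and> f w = d} = nbrs G v \<inter> {w. f w = d}"
    by (auto simp: nbrs_def)
  then show ?thesis
    using assms by (simp add: env_def of_bool_def sum.If_cases)
qed

lemma env_cong:
  assumes "\<And>w. w \<in> nbrs G v \<Longrightarrow> f w = g w"
  shows "env G (f, v) = env G (g, v)"
  unfolding env_def using assms by (auto simp: nbrs_def intro!: arg_cong[where f = card])

lemma env_pos_iff:
  assumes "finite (parcs G)"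
  shows "env G s d > 0 \<longleftrightarrow> (\<exists>w\<in>nbrs G (snd s). fst s w = d)"
proof -
  have "{w. (snd s, w) \<in> parcs G \<and> fst s w = d} = {w \<in> nbrs G (snd s). fst s w = d}"
    by (simp add: nbrs_def)
  then show ?thesis
    using finite_nbrs[OF assms] by (auto simp: env_def card_gt_0_iff)
qed

lemma finite_env_support:
  assumes "finite (parcs G)"
  shows "finite {d. env G s d \<noteq> 0}"
proof (rule finite_subset)
  show "{d. env G s d \<noteq> 0} \<subseteq> fst s ` nbrs G (snd s)"
    using env_pos_iff[OF assms, of s] by auto
  show "finite (fst s ` nbrs G (snd s))"
    using finite_nbrs[OF assms] by blast
qed

lemma decide_MoveD:
  assumes "is_algorithm mv" "finite (parcs G)" "decide mv G s = Move c1 d"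
  shows "\<exists>w\<in>nbrs G (snd s). fst s w = d"
    and "fst s (snd s) \<noteq> 0 \<Longrightarrow> c1 = fst s (snd s)"
proof -
  have "env G s d > 0 \<and> (fst s (snd s) \<noteq> 0 \<longrightarrow> c1 = fst s (snd s))"
    using assms(1,3) finite_env_support[OF assms(2), of s]
    unfolding is_algorithm_def decide_def by blast
  then show "\<exists>w\<in>nbrs G (snd s). fst s w = d"
    and "fst s (snd s) \<noteq> 0 \<Longrightarrow> c1 = fst s (snd s)"
    using env_pos_iff[OF assms(2), of s] by auto
qed

lemma stepI:
  assumes "decide mv G (f, v) = Move c1 d" "w \<in> nbrs G v" "f w = d"
  shows "step mv G (f, v) (f(v := c1), w)"
  using assms by (auto simp: step_def nbrs_def)

text \<open>Partial runs that have not stopped. The set \<open>V\<close> records the visited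
  vertices, because each trap rests on some vertex that has not been visited so far.\<close>

inductive leads :: "algorithm \<Rightarrow> 'v pair_pre_digraph \<Rightarrow> 'v \<Rightarrow> 'v set \<Rightarrow> 'v state \<Rightarrow> bool"
  for mv G v0 where
  init: "leads mv G v0 {v0} (\<lambda>_. 0, v0)"
| step: "leads mv G v0 V s \<Longrightarrow> step mv G s s' \<Longrightarrow> leads mv G v0 (insert (snd s') V) s'"

lemma leads_prefix:
  assumes "leads mv G v0 V s"
  shows "\<exists>p n. p 0 = (\<lambda>_. 0, v0) \<and> p n = s \<and> (\<forall>t<n. step mv G (p t) (p (Suc t))) \<and>
    V = (\<lambda>t. snd (p t)) ` {..n}"
  using assms
proof induction
  case init
  show ?case by (rule exI[of _ "\<lambda>_. (\<lambda>_. 0, v0)"], rule exI[of _ 0]) auto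
next
  case (step V s s')
  then obtain p n where p: "p 0 = (\<lambda>_. 0, v0)" "p n = s" "\<forall>t<n. step mv G (p t) (p (Suc t))"
    "V = (\<lambda>t. snd (p t)) ` {..n}" by blast
  let ?q = "p(Suc n := s')"
  have "(\<lambda>t. snd (?q t)) ` {..Suc n} = insert (snd s') ((\<lambda>t. snd (?q t)) ` {..n})"
    by (simp add: atMost_Suc)
  also have "(\<lambda>t. snd (?q t)) ` {..n} = V"
    unfolding p(4) by (rule image_cong) auto
  finally have V: "insert (snd s') V = (\<lambda>t. snd (?q t)) ` {..Suc n}" by simp
  have "\<forall>t<Suc n. step mv G (?q t) (?q (Suc t))"
    using p(2,3) step.hyps(2) by (auto simp: less_Suc_eq)
  then show ?case
    using p(1) V by (intro exI[of _ ?q] exI[of _ "Suc n"]) simp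
qed

text \<open>An adversary is given by an invariant that it can maintain, so no strategy has to be
  written down: a choice of successors continues the finite run inside \<open>I\<close> for
  ever.\<close>

lemma run_through:
  assumes "leads mv G v0 V s" "v0 \<in> pverts G" "I s"
    and step: "\<forall>s. I s \<longrightarrow> decide mv G s \<noteq> Stop \<longrightarrow> (\<exists>s'. step mv G s s' \<and> I s')"
  shows "\<exists>r n. is_run mv G r \<and> r 0 = (\<lambda>_. 0, v0) \<and> r n = s \<and> V = (\<lambda>t. snd (r t)) ` {..n} \<and>
    (\<forall>t<n. decide mv G (r t) \<noteq> Stop) \<and> (\<forall>t\<ge>n. I (r t))"
proof -
  obtain p n where p: "p 0 = (\<lambda>_. 0, v0)" "p n = s" "\<forall>t<n. step mv G (p t) (p (Suc t))"
    "V = (\<lambda>t. snd (p t)) ` {..n}" using leads_prefix[OF assms(1)] by blast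
  \<comment> \<open>At \<open>Stop\<close> the state is repeated, as \<open>is_run\<close>
    demands.\<close>
  define nx where "nx s = (if decide mv G s = Stop then s else SOME s'. step mv G s s' \<and> I s')" for s
  have nx: "I (nx s) \<and> (if decide mv G s = Stop then nx s = s else step mv G s (nx s))"
    if "I s" for s
    using someI_ex[OF step[rule_format, OF that]] that by (auto simp: nx_def)
  define r where "r t = (if t \<le> n then p t else (nx ^^ (t - n)) s)" for t
  have I: "I ((nx ^^ m) s)" for m
    by (induction m) (use nx assms(3) in auto)
  have tail: "r (n + m) = (nx ^^ m) s" for m
    using p(2) by (cases m) (auto simp: r_def)
  have moves: "decide mv G (r t) \<noteq> Stop" and steps: "step mv G (r t) (r (Suc t))" if "t < n" for t
    using p(3) that by (auto simp: r_def step_def)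
  have "if decide mv G (r t) = Stop then r (Suc t) = r t else step mv G (r t) (r (Suc t))" for t
  proof (cases "t < n")
    case True
    then show ?thesis using moves steps by auto
  next
    case False
    then obtain m where t: "t = n + m" by (metis le_add_diff_inverse not_less)
    have "r (Suc t) = nx (r t)" using tail[of m] tail[of "Suc m"] by (simp add: t)
    then show ?thesis using nx[OF I[of m]] tail[of m] by (simp add: t)
  qed
  moreover have r0: "r 0 = (\<lambda>_. 0, v0)" using p(1) by (simp add: r_def)
  ultimately have run: "is_run mv G r"
    using assms(2) by (simp add: is_run_def)
  have V: "V = (\<lambda>t. snd (r t)) ` {..n}"
    unfolding p(4) by (rule image_cong) (auto simp: r_def)
  have "\<forall>t\<ge>n. I (r t)"
  proof (intro allI impI)
    fix t assume "n \<le> t"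
    then obtain m where t: "t = n + m" using le_Suc_ex by blast
    show "I (r t)" using tail I by (simp add: t)
  qed
  moreover have "r n = s" using p(2) by (simp add: r_def)
  ultimately show ?thesis
    using run r0 V moves by (intro exI[of _ r] exI[of _ n]) simp
qed

text \<open>Used in contrapositive form: an adversary wins if its invariant excludes an unvisited
  vertex, or excludes stopping at \<open>v0\<close>.\<close>

lemma explores_invariant:
  assumes "explores mv G" "leads mv G v0 V s" "v0 \<in> pverts G" "I s"
    and "\<forall>s. I s \<longrightarrow> decide mv G s \<noteq> Stop \<longrightarrow> (\<exists>s'. step mv G s s' \<and> I s')"
  shows "(\<exists>s. I s \<and> snd s = v0 \<and> decide mv G s = Stop) \<and>
    (\<forall>v\<in>pverts G. v \<in> V \<or> (\<exists>s. I s \<and> snd s = v))"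
proof -
  have "\<exists>r n. is_run mv G r \<and> r 0 = (\<lambda>_. 0, v0) \<and> r n = s \<and> V = (\<lambda>t. snd (r t)) ` {..n} \<and>
    (\<forall>t<n. decide mv G (r t) \<noteq> Stop) \<and> (\<forall>t\<ge>n. I (r t))"
    by (rule run_through) (fact assms)+
  then obtain r n where r: "is_run mv G r" "r 0 = (\<lambda>_. 0, v0)" "r n = s" "V = (\<lambda>t. snd (r t)) ` {..n}"
    "\<forall>t<n. decide mv G (r t) \<noteq> Stop" "\<forall>t\<ge>n. I (r t)"
    by blast
  have "snd (r 0) = v0" using r(2) by simp
  then obtain t where t: "\<forall>v \<in> pverts G. \<exists>i\<le>t. snd (r i) = v" "snd (r t) = v0" "decide mv G (r t) = Stop"
    using assms(1)[unfolded explores_def, rule_format, OF r(1)] by blast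
  \<comment> \<open>No state before time \<open>n\<close> has decision \<open>Stop\<close>, so the
    run ends within the reach of \<open>I\<close>.\<close>
  have "n \<le> t" using r(5) t(3) not_less by blast
  then have "\<exists>s. I s \<and> snd s = v0 \<and> decide mv G s = Stop" using r(6) t by blast
  moreover have "v \<in> V \<or> (\<exists>s. I s \<and> snd s = v)" if v: "v \<in> pverts G" for v
  proof -
    obtain i where i: "snd (r i) = v" using t(1) v by blast
    show ?thesis
    proof (cases "i \<le> n")
      case True
      then show ?thesis using i r(4) by auto
    next
      case False
      then have "I (r i)" using r(6) by simp
      then show ?thesis using i by blast
    qed
  qed
  ultimately show ?thesis by blast
qed

text \<open>
  The adversary keeps the agent inside \<open>Q\<close>: instead of a neighbour outside \<open>Q\<close> it offers one inside
  \<open>Q\<close> of the same colour.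
\<close>

lemma twin_trap:
  assumes "is_algorithm mv" "finite (parcs G)" "explores mv G"
    and "leads mv G v0 V s" "v0 \<in> pverts G" "snd s \<in> Q"
    and twins: "\<And>a b. a \<in> Q \<Longrightarrow> b \<in> nbrs G a \<Longrightarrow> b \<notin> Q \<Longrightarrow>
      \<exists>b'\<in>nbrs G a \<inter> Q. fst s b \<noteq> 0 \<and> fst s b' = fst s b"
  shows "pverts G \<subseteq> V \<union> Q"
proof -
  \<comment> \<open>Nonzero colours are permanent, so twins that agree now agree for ever.\<close>
  define I where "I s' \<longleftrightarrow> snd s' \<in> Q \<and> (\<forall>v. fst s v \<noteq> 0 \<longrightarrow> fst s' v = fst s v)" for s'
  have "\<exists>s''. step mv G s' s'' \<and> I s''" if I: "I s'" and go: "decide mv G s' \<noteq> Stop" for s'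
  proof -
    obtain c1 d where dec: "decide mv G s' = Move c1 d" using go by (cases "decide mv G s'") auto
    note mvD = decide_MoveD[OF assms(1,2) dec]
    obtain w where w: "w \<in> nbrs G (snd s')" "fst s' w = d" using mvD(1) by blast
    have "\<exists>w\<in>nbrs G (snd s') \<inter> Q. fst s' w = d"
    proof (cases "w \<in> Q")
      case False
      then obtain b' where "b' \<in> nbrs G (snd s') \<inter> Q" "fst s w \<noteq> 0" "fst s b' = fst s w"
        using twins[of "snd s'" w] I w(1) by (auto simp: I_def)
      then show ?thesis using I w(2) by (auto simp: I_def)
    qed (use w in blast)
    then obtain w' where w': "w' \<in> nbrs G (snd s')" "w' \<in> Q" "fst s' w' = d" by blast
    have "step mv G s' ((fst s')(snd s' := c1), w')"
      using stepI[of mv G "fst s'" "snd s'" c1 d w'] dec w' by simp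
    moreover have "I ((fst s')(snd s' := c1), w')"
      using I w'(2) mvD(2) by (auto simp: I_def)
    ultimately show ?thesis by blast
  qed
  moreover have "I s" using assms(6) by (simp add: I_def)
  ultimately show ?thesis
    using explores_invariant[OF assms(3-5), of I] by (auto simp: I_def)
qed

lemma color_used:
  assumes "is_run mv G r" "fst (r t) v \<noteq> 0"
  shows "fst (r t) v \<in> colors_used mv G r"
  using assms(2)
proof (induction t arbitrary: v)
  case 0
  then show ?case using assms(1) by (simp add: is_run_def)
next
  case (Suc t)
  have *: "if decide mv G (r t) = Stop then r (Suc t) = r t else step mv G (r t) (r (Suc t))"
    using assms(1) by (simp add: is_run_def)
  show ?case
  proof (cases "decide mv G (r t) = Stop")
    case False
    then obtain c1 d where "decide mv G (r t) = Move c1 d" "fst (r (Suc t)) = (fst (r t))(snd (r t) := c1)"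
      using * by (auto simp: step_def)
    then show ?thesis using Suc by (auto simp: colors_used_def split: if_splits)
  qed (use * Suc in auto)
qed

text \<open>Smaller neighbours lead every vertex down to 0, and symmetry joins two such
  descents.\<close>

lemma connected_graphI:
  fixes G :: "nat pair_pre_digraph"
  assumes fin: "finite (pverts G)" and sub: "parcs G \<subseteq> pverts G \<times> pverts G" and "sym (parcs G)"
    and irrefl: "\<And>v. (v, v) \<notin> parcs G" and zero: "0 \<in> pverts G"
    and down: "\<And>v. v \<in> pverts G \<Longrightarrow> v \<noteq> 0 \<Longrightarrow> \<exists>u<v. (v, u) \<in> parcs G"
  shows "connected_graph G"
proof -
  have "finite (parcs G)" using fin sub finite_subset by blast
  then interpret pair_graph G
    using assms(1-3) irrefl by unfold_locales (auto simp: symmetric_def)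
  have to_zero: "(v, 0) \<in> rtrancl_on (pverts G) ((parcs G)\<^sup>s)" if "v \<in> pverts G" for v
    using that
  proof (induction v rule: less_induct)
    case (less v)
    show ?case
    proof (cases "v = 0")
      case False
      then obtain u where u: "u < v" "(v, u) \<in> parcs G" using down less.prems by blast
      then have "u \<in> pverts G" using sub by auto
      then show ?thesis
        using less.IH[OF u(1)] u(2) less.prems
        by (auto simp: symcl_def intro: converse_rtrancl_on_into_rtrancl_on)
    qed (use zero in auto)
  qed
  have "sym (rtrancl_on (pverts G) ((parcs G)\<^sup>s))"
    by (rule rtrancl_on_sym) (auto simp: sym_def symcl_def)
  then have "(u, v) \<in> rtrancl_on (pverts G) ((parcs G)\<^sup>s)" if "u \<in> pverts G" "v \<in> pverts G" for u v
    using to_zero[OF that(1)] to_zero[OF that(2)] by (metis rtrancl_on_trans symE)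
  then have "connected (with_proj G)"
    using zero by (auto simp: connected_conv)
  then show ?thesis
    unfolding connected_graph_def by (auto intro: pair_graph_axioms)
qed

section \<open>Caterpillars\<close>

text \<open>
  A path \<open>0, \<dots>, K\<close> in which every \<open>j < K\<close> has one further neighbour: the leaf \<open>K + 1 + j\<close> or, for
  \<open>j \<in> A\<close>, the end \<open>K\<close> of the path.  The vertices from \<open>2 * K + 1\<close> on are leaves attached to \<open>h\<close>.
\<close>

definition cat_verts :: "nat \<Rightarrow> nat set \<Rightarrow> nat \<Rightarrow> nat set" where
  "cat_verts K A N = {m. m < N \<and> (\<forall>j\<in>A. m \<noteq> K + 1 + j)}"

definition cat_up :: "nat \<Rightarrow> nat set \<Rightarrow> nat \<Rightarrow> nat \<Rightarrow> nat rel" where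
  "cat_up K A h N = {(m, u). m \<le> K \<and> m = Suc u \<or> u < K \<and> u \<notin> A \<and> m = K + 1 + u \<or>
     2 * K < m \<and> m < N \<and> u = h \<or> m \<in> A \<and> u = K}"

definition cat :: "nat \<Rightarrow> nat set \<Rightarrow> nat \<Rightarrow> nat \<Rightarrow> nat pair_pre_digraph" where
  "cat K A h N = \<lparr>pverts = cat_verts K A N, parcs = cat_up K A h N \<union> (cat_up K A h N)\<inverse>\<rparr>"

text \<open>The parity condition lets each chord \<open>j\<close>-\<open>K\<close> respect the
  bipartition, and \<open>j + 1 < K\<close> keeps it distinct from the last path edge. The hub
  \<open>h\<close> is the end of the path or an existing leaf, so the extra leaves never change the
  neighbourhood of a vertex \<open>j < K\<close>.\<close>

locale caterpillar =
  fixes K :: nat and A :: "nat set" and h N :: nat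
  assumes size: "2 * K < N" and A: "\<And>j. j \<in> A \<Longrightarrow> j + 1 < K \<and> odd (j + K)"
    and hub: "K \<le> h" "h \<le> 2 * K" "\<And>j. j \<in> A \<Longrightarrow> h \<noteq> K + 1 + j"
begin

abbreviation "H \<equiv> cat K A h N"

definition spare :: "nat \<Rightarrow> nat" where
  "spare j = (if j \<in> A then K else K + 1 + j)"

lemma pverts_H: "v \<in> pverts H \<longleftrightarrow> v < N \<and> (\<forall>j\<in>A. v \<noteq> K + 1 + j)"
  by (simp add: cat_def cat_verts_def)

lemma up_verts: "(m, u) \<in> cat_up K A h N \<Longrightarrow> m \<in> pverts H \<and> u \<in> pverts H"
  using A hub size by (fastforce simp: cat_up_def cat_def cat_verts_def)

lemma parcs_H: "parcs H \<subseteq> pverts H \<times> pverts H"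
  using up_verts by (auto simp: cat_def)

lemma finite_pverts_H: "finite (pverts H)"
  by (simp add: cat_def cat_verts_def)

lemma finite_parcs_H: "finite (parcs H)"
  using parcs_H finite_pverts_H finite_subset by blast

lemma zero_in_H: "0 \<in> pverts H"
  using size by (simp add: pverts_H)

lemma connected_H: "connected_graph H"
proof (rule connected_graphI)
  show "sym (parcs H)" by (auto simp: cat_def sym_def)
  show "(v, v) \<notin> parcs H" for v
    using A hub by (auto simp: cat_def cat_up_def)
  fix v assume v: "v \<in> pverts H" "v \<noteq> 0"
  consider "v \<le> K" | "K < v" "v \<le> 2 * K" | "2 * K < v" by linarith
  then show "\<exists>u<v. (v, u) \<in> parcs H"
  proof cases
    case 1
    then show ?thesis using v(2) by (intro exI[of _ "v - 1"]) (auto simp: cat_def cat_up_def)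
  next
    case 2
    then have "v = K + 1 + (v - (K + 1))" by simp
    then have "v - (K + 1) \<notin> A" using v(1) unfolding pverts_H by blast
    then show ?thesis using 2 by (intro exI[of _ "v - (K + 1)"]) (auto simp: cat_def cat_up_def)
  next
    case 3
    moreover have "v < N" using v(1) by (simp add: pverts_H)
    ultimately show ?thesis using hub by (intro exI[of _ h]) (auto simp: cat_def cat_up_def)
  qed
qed (use finite_pverts_H parcs_H zero_in_H in auto)

lemma bipartite_H: "bipartite H"
proof -
  \<comment> \<open>Path vertices are split by parity; a leaf \<open>K + 1 + u\<close> lies opposite
    to \<open>u\<close>, and the extra leaves lie opposite to the hub.\<close>
  define side0 where "side0 m = (if m \<le> K then even m else odd (m - (K + 1)))" for m
  define side where "side m = (if m \<le> 2 * K then side0 m else \<not> side0 h)" for m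
  have "side m \<noteq> side u" if up: "(m, u) \<in> cat_up K A h N" for m u
  proof -
    consider "m \<le> K" "m = Suc u" | "u < K" "m = K + 1 + u" | "2 * K < m" "u = h" | "m \<in> A" "u = K"
      using up by (auto simp: cat_up_def)
    then show ?thesis
      using A[of m] hub by cases (auto simp: side_def side0_def)
  qed
  then have flip: "side m \<noteq> side u" if "(m, u) \<in> parcs H" for m u
    using that unfolding cat_def by auto
  show ?thesis unfolding bipartite_def
  proof (intro exI conjI)
    show "pverts H = {v \<in> pverts H. side v} \<union> {v \<in> pverts H. \<not> side v}" by auto
    have "(u \<in> pverts H \<and> side u \<and> v \<in> pverts H \<and> \<not> side v) \<or>
      (u \<in> pverts H \<and> \<not> side u \<and> v \<in> pverts H \<and> side v)" if "(u, v) \<in> parcs H" for u v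
      using flip[OF that] that parcs_H by auto
    then show "\<forall>(u, v)\<in>parcs H. u \<in> {v \<in> pverts H. side v} \<and> v \<in> {v \<in> pverts H. \<not> side v} \<or>
      u \<in> {v \<in> pverts H. \<not> side v} \<and> v \<in> {v \<in> pverts H. side v}"
      by (simp add: Ball_def)
  qed auto
qed

lemma in_nbrs_H: "w \<in> nbrs H v \<longleftrightarrow> (v, w) \<in> cat_up K A h N \<or> (w, v) \<in> cat_up K A h N"
  by (simp add: nbrs_def cat_def)

lemma nbrs_path:
  assumes "j < K"
  shows "nbrs H j = {i. j = Suc i} \<union> {j + 1, spare j}"
proof -
  have "w \<in> nbrs H j \<longleftrightarrow> j = Suc w \<or> w = j + 1 \<or> w = spare j" for w
    using assms A[of w] hub size by (auto simp: in_nbrs_H cat_up_def spare_def)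
  then show ?thesis by auto
qed

lemma nbrs_end:
  assumes "0 < K"
  shows "nbrs H K = {K - 1} \<union> A \<union> (if h = K then {2 * K + 1..<N} else {})"
proof -
  have "w \<in> nbrs H K \<longleftrightarrow> w = K - 1 \<or> w \<in> A \<or> h = K \<and> 2 * K + 1 \<le> w \<and> w < N" for w
    using assms A[of w] A[of K] hub by (auto simp: in_nbrs_H cat_up_def)
  then show ?thesis by (simp add: set_eq_iff)
qed

lemma nbrs_leaf:
  assumes "j < K" "j \<notin> A"
  shows "nbrs H (K + 1 + j) = {j} \<union> (if h = K + 1 + j then {2 * K + 1..<N} else {})"
proof -
  have "w \<in> nbrs H (K + 1 + j) \<longleftrightarrow> w = j \<or> h = K + 1 + j \<and> 2 * K + 1 \<le> w \<and> w < N" for w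
    using assms A[of "K + 1 + j"] hub by (auto simp: in_nbrs_H cat_up_def)
  then show ?thesis by (simp add: set_eq_iff)
qed

lemma nbrs_extra:
  assumes "2 * K < m" "m < N"
  shows "nbrs H m = {h}"
proof -
  have "w \<in> nbrs H m \<longleftrightarrow> w = h" for w
    using assms A[of m] hub by (auto simp: in_nbrs_H cat_up_def)
  then show ?thesis by (simp add: set_eq_iff)
qed

end

section \<open>Walking along a path\<close>

fun colour_of :: "decision \<Rightarrow> nat" where
  "colour_of Stop = 0"
| "colour_of (Move c d) = c"

text \<open>
  The environment of a new path vertex: the predecessor has colour \<open>e\<close>, and \<open>e = 0\<close> encodes that
  there is none.  Thus \<open>hue mv (Suc j)\<close> is the colour that path vertex \<open>j\<close> receives.
\<close>

definition fresh_env :: "nat \<Rightarrow> nat \<Rightarrow> nat" where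
  "fresh_env e d = of_bool (e \<noteq> 0 \<and> e = d) + 2 * of_bool (d = 0)"

definition hue :: "algorithm \<Rightarrow> nat \<Rightarrow> nat" where
  "hue mv k = ((\<lambda>e. colour_of (mv 0 (fresh_env e))) ^^ k) 0"

lemma hue_0 [simp]: "hue mv 0 = 0"
  by (simp add: hue_def)

lemma hue_Suc: "hue mv (Suc k) = colour_of (mv 0 (fresh_env (hue mv k)))"
  by (simp add: hue_def)

lemma hue_shift: "hue mv i = hue mv j \<Longrightarrow> hue mv (i + m) = hue mv (j + m)"
  by (induction m) (simp_all add: hue_Suc)

text \<open>What caterpillars and fans have in common: beside the path, each \<open>j < K\<close>
  sees one vertex \<open>z j\<close> from \<open>K\<close> on. As \<open>z\<close> may be constant,
  one vertex can serve all of them.\<close>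

definition pathlike :: "nat pair_pre_digraph \<Rightarrow> (nat \<Rightarrow> nat) \<Rightarrow> nat \<Rightarrow> bool" where
  "pathlike G z K \<longleftrightarrow> 0 \<in> pverts G \<and> finite (parcs G) \<and>
     (\<forall>j<K. nbrs G j = {i. j = Suc i} \<union> {j + 1, z j} \<and> K \<le> z j \<and> z j \<noteq> j + 1)"

lemma (in caterpillar) pathlike_H: "pathlike H spare K"
proof -
  have "K \<le> spare j \<and> spare j \<noteq> j + 1" if "j < K" for j
    using that A[of j] by (auto simp: spare_def)
  then show ?thesis
    by (simp add: pathlike_def zero_in_H finite_parcs_H nbrs_path)
qed

definition trail :: "algorithm \<Rightarrow> nat \<Rightarrow> nat \<Rightarrow> nat" where
  "trail mv k v = (if v < k then hue mv (Suc v) else 0)"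

text \<open>Meant for \<open>i \<le> k\<close>: then the predecessor \<open>i - 1\<close> is
  coloured, with \<open>hue mv i\<close>. The last summand is the spare neighbour, which lies beyond
  the coloured part.\<close>

definition trail_env :: "algorithm \<Rightarrow> nat \<Rightarrow> nat \<Rightarrow> nat \<Rightarrow> nat" where
  "trail_env mv k i d = of_bool (i > 0 \<and> hue mv i = d) + of_bool (trail mv k (Suc i) = d) + of_bool (d = 0)"

definition trail_decision :: "algorithm \<Rightarrow> nat \<Rightarrow> nat \<Rightarrow> decision" where
  "trail_decision mv k i = mv (trail mv k i) (trail_env mv k i)"

lemma decide_trail:
  assumes G: "pathlike G z K" and "i < K" "i \<le> k" "k \<le> K"
  shows "decide mv G (trail mv k, i) = trail_decision mv k i"
proof -
  have N: "nbrs G i = {j. i = Suc j} \<union> {i + 1, z i}" "K \<le> z i" "z i \<noteq> i + 1"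
    using G assms(2) by (auto simp: pathlike_def)
  have fin: "finite (nbrs G i)" using G by (simp add: pathlike_def finite_nbrs)
  have "env G (trail mv k, i) d = trail_env mv k i d" for d
  proof (cases i)
    case 0
    then have "nbrs G i = {i + 1, z i}" using N by auto
    then show ?thesis using N assms 0
      unfolding env_eq_sum[OF fin] by (simp add: trail_env_def) (simp add: trail_def)
  next
    case (Suc i')
    then have "nbrs G i = {i', i + 1, z i}" using N by auto
    then show ?thesis using N assms Suc
      unfolding env_eq_sum[OF fin] by (simp add: trail_env_def) (simp add: trail_def)
  qed
  then have "env G (trail mv k, i) = trail_env mv k i" by blast
  then show ?thesis by (simp add: decide_def trail_decision_def)
qed

text \<open>At the front both the successor and the spare neighbour are uncoloured. The predecessor
  must have a nonzero colour since \<open>fresh_env 0\<close> stands for its absence.\<close>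

lemma trail_decision_fresh:
  assumes "k > 0 \<Longrightarrow> hue mv k \<noteq> 0"
  shows "trail_decision mv k k = mv 0 (fresh_env (hue mv k))"
proof -
  have "trail_env mv k k = fresh_env (hue mv k)"
    using assms by (cases "k = 0") (auto simp: trail_env_def fresh_env_def trail_def fun_eq_iff)
  then show ?thesis by (simp add: trail_decision_def trail_def)
qed

lemma trail_upd [simp]:
  "i < k \<Longrightarrow> (trail mv k)(i := hue mv (Suc i)) = trail mv k"
  "k \<le> i \<Longrightarrow> (trail mv k)(i := 0) = trail mv k"
  "(trail mv k)(k := hue mv (Suc k)) = trail mv (Suc k)"
  by (auto simp: trail_def fun_eq_iff)

text \<open>The bound \<open>m\<close> is the length of path that has to be present for the state to be reached.\<close>

definition attains :: "algorithm \<Rightarrow> nat \<Rightarrow> nat \<Rightarrow> nat \<Rightarrow> bool" where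
  "attains mv m k i \<longleftrightarrow>
     (\<forall>G z K. pathlike G z K \<and> m \<le> K \<longrightarrow> (\<exists>V\<subseteq>{..k}. leads mv G 0 V (trail mv k, i)))"

definition always_step :: "algorithm \<Rightarrow> nat \<Rightarrow> (nat \<Rightarrow> nat) \<times> nat \<Rightarrow> (nat \<Rightarrow> nat) \<times> nat \<Rightarrow> bool" where
  "always_step mv m s s' \<longleftrightarrow> (\<forall>G z K. pathlike G z K \<and> m \<le> K \<longrightarrow> step mv G s s')"

lemma always_step_mono: "always_step mv m s s' \<Longrightarrow> m \<le> m' \<Longrightarrow> always_step mv m' s s'"
  by (meson always_step_def le_trans)

lemma attains_step:
  assumes "attains mv m k i" "always_step mv m' (trail mv k, i) (trail mv k', i')"
    and "m \<le> m'" "k \<le> k'" "i' \<le> k'"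
  shows "attains mv m' k' i'"
  unfolding attains_def
proof (intro allI impI)
  fix G z K assume G: "pathlike G z K \<and> m' \<le> K"
  then have "pathlike G z K \<and> m \<le> K" using assms(3) by simp
  then obtain V where V: "V \<subseteq> {..k}" "leads mv G 0 V (trail mv k, i)"
    using assms(1) unfolding attains_def by blast
  have "step mv G (trail mv k, i) (trail mv k', i')"
    using assms(2) G unfolding always_step_def by blast
  then have "leads mv G 0 (insert i' V) (trail mv k', i')"
    using leads.step[OF V(2)] by fastforce
  moreover have "insert i' V \<subseteq> {..k'}" using V(1) assms(4,5) by auto
  ultimately show "\<exists>V\<subseteq>{..k'}. leads mv G 0 V (trail mv k', i')" by blast
qed

lemma always_stepI:
  assumes "trail_decision mv k i = Move c1 d" "i < m" "i \<le> k" "k \<le> m"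
    and "i = Suc i' \<or> i' = Suc i" "trail mv k i' = d" "(trail mv k)(i := c1) = trail mv k'"
  shows "always_step mv m (trail mv k, i) (trail mv k', i')"
  unfolding always_step_def
proof (intro allI impI)
  fix G z K assume G: "pathlike G z K \<and> m \<le> K"
  then have "decide mv G (trail mv k, i) = Move c1 d"
    using decide_trail[of G z K i k mv] assms(1-4) by simp
  moreover have "i' \<in> nbrs G i"
    using G assms(2,5) by (auto simp: pathlike_def)
  ultimately show "step mv G (trail mv k, i) (trail mv k', i')"
    using stepI[of mv G "trail mv k" i c1 d i'] assms(6,7) by simp
qed

section \<open>Behaviour of an explorer on the path\<close>

locale explorer =
  fixes mv :: algorithm
  assumes alg: "is_algorithm mv"
    and explores: "\<And>G :: nat pair_pre_digraph. connected_graph G \<Longrightarrow> bipartite G \<Longrightarrow> explores mv G"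

lemma (in caterpillar) visits:
  assumes "explorer mv" "leads mv H 0 V s" "I s"
    and "\<forall>s. I s \<longrightarrow> decide mv H s \<noteq> Stop \<longrightarrow> (\<exists>s'. step mv H s s' \<and> I s')"
  shows "\<exists>s. I s \<and> snd s = 0 \<and> decide mv H s = Stop"
    and "v \<in> pverts H \<Longrightarrow> v \<in> V \<or> (\<exists>s. I s \<and> snd s = v)"
  using explores_invariant[OF explorer.explores[OF assms(1) connected_H bipartite_H] assms(2) zero_in_H, of I]
    assms(3,4) by blast+

context explorer
begin

abbreviation positive :: "nat \<Rightarrow> bool" where
  "positive k \<equiv> \<forall>j<k. hue mv (Suc j) \<noteq> 0"

text \<open>If the adversary can keep the agent within \<open>P\<close>, the leaf
  \<open>2 * K\<close> of a caterpillar is never visited. The path length \<open>Suc m\<close>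
  exceeds \<open>k\<close>, so even the front \<open>k\<close> has its full path
  neighbourhood.\<close>

lemma no_endless_walk:
  assumes "attains mv m k i" "k \<le> m" "i \<in> P" "P \<subseteq> {..k}"
    and moves: "\<forall>i\<in>P. trail_decision mv k i \<noteq> Stop \<longrightarrow>
      (\<exists>i'\<in>P. always_step mv (Suc m) (trail mv k, i) (trail mv k, i'))"
  shows False
proof -
  define K where "K = Suc m"
  interpret caterpillar K "{}" K "2 * K + 1"
    by unfold_locales auto
  obtain V where V: "V \<subseteq> {..k}" "leads mv H 0 V (trail mv k, i)"
    using assms(1) pathlike_H unfolding attains_def K_def by (metis Suc_n_not_le_n nat_le_linear)
  define I where "I s \<longleftrightarrow> (\<exists>i\<in>P. s = (trail mv k, i))" for s
  have "\<exists>s'. step mv H s s' \<and> I s'" if I: "I s" and go: "decide mv H s \<noteq> Stop" for s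
  proof -
    obtain j where j: "j \<in> P" "s = (trail mv k, j)" using I by (auto simp: I_def)
    moreover have "j < K" "j \<le> k" "k \<le> K" using j assms(2,4) by (auto simp: K_def)
    ultimately have "decide mv H s = trail_decision mv k j"
      using decide_trail[OF pathlike_H] by simp
    then obtain i' where "i' \<in> P" "always_step mv (Suc m) (trail mv k, j) (trail mv k, i')"
      using moves j go by auto
    then show ?thesis
      using pathlike_H j by (auto simp: always_step_def I_def K_def)
  qed
  moreover have "I (trail mv k, i)" using assms(3) by (simp add: I_def)
  moreover have "explorer mv" ..
  moreover have "2 * K \<in> pverts H" by (subst pverts_H) simp
  ultimately have "2 * K \<in> V \<or> (\<exists>s. I s \<and> snd s = 2 * K)"
    using visits(2)[of mv V "(trail mv k, i)" I "2 * K"] V(2) by blast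
  then show False
    using V(1) assms(2,4) by (auto simp: I_def K_def)
qed

text \<open>A stopped agent is an endless walk in the single position \<open>i\<close>.\<close>

lemma not_Stop:
  assumes "attains mv m k i" "i \<le> k" "k \<le> m"
  shows "trail_decision mv k i \<noteq> Stop"
  using no_endless_walk[OF assms(1,3), of "{i}"] assms(2) by auto

text \<open>
  If the agent leaves \<open>i\<close> for its spare neighbour \<open>w\<close>, then \<open>w\<close> gets the colour of \<open>i + 1\<close>, and the
  adversary offers \<open>w\<close> instead of \<open>i + 1\<close> ever after.
\<close>

lemma no_stray:
  assumes att: "attains mv m k i" and le: "i + 1 < k" "k \<le> m" and pos: "positive k"
    and dec: "trail_decision mv k i = Move c1 0"
  shows False
proof -
  \<comment> \<open>The leaf \<open>w\<close> of \<open>i\<close> is the hub and carries two extra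
    leaves. It thus sees the colour of \<open>i\<close> and two uncoloured vertices, just as
    \<open>i + 1\<close> did when it was fresh.\<close>
  define w N where "w = m + 1 + i" and "N = 2 * m + 3"
  interpret caterpillar m "{}" w N
    using le by unfold_locales (auto simp: w_def N_def)
  have sp: "spare j = m + 1 + j" for j by (simp add: spare_def)
  obtain V where V: "V \<subseteq> {..k}" "leads mv H 0 V (trail mv k, i)"
    using att pathlike_H unfolding attains_def by blast
  have decH: "decide mv H (trail mv k, i) = Move c1 0"
    using decide_trail[OF pathlike_H, of i k mv] le dec by simp
  have tr: "trail mv k i = hue mv (Suc i)" "trail mv k (Suc i) = hue mv (Suc (Suc i))"
    "trail mv k w = 0" and tr_out: "\<And>v. k \<le> v \<Longrightarrow> trail mv k v = 0"
    using le by (auto simp: trail_def w_def)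
  have hues: "hue mv (Suc i) \<noteq> 0" "hue mv (Suc (Suc i)) \<noteq> 0"
    using pos le by auto
  have c1: "c1 = hue mv (Suc i)"
    using decide_MoveD(2)[OF alg finite_parcs_H decH] tr hues by simp
  have nbrs_i: "nbrs H i = {j. i = Suc j} \<union> {i + 1, w}"
    using nbrs_path[of i] le by (simp add: sp w_def)
  have nbrs_w: "nbrs H w = {i, 2 * m + 1, 2 * m + 2}"
  proof -
    have "{2 * m + 1..<N} = {2 * m + 1, 2 * m + 2}" by (auto simp: N_def)
    then show ?thesis using nbrs_leaf[of i] le by (simp add: w_def insert_commute)
  qed
  have "step mv H (trail mv k, i) (trail mv k, w)"
    using stepI[OF decH, of w] nbrs_i tr le by (simp add: c1)
  then have L1: "leads mv H 0 (insert w V) (trail mv k, w)"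
    using leads.step[OF V(2)] by fastforce
  have "env H (trail mv k, w) d = fresh_env (hue mv (Suc i)) d" for d
  proof -
    have "env H (trail mv k, w) d = (\<Sum>v\<in>{i, 2 * m + 1, 2 * m + 2}. of_bool (trail mv k v = d))"
      using env_eq_sum[OF finite_nbrs[OF finite_parcs_H], of "trail mv k" w d] by (simp only: nbrs_w)
    also have "\<dots> = fresh_env (hue mv (Suc i)) d"
      using le tr(1) tr_out[of "2 * m + 1"] tr_out[of "2 * m + 2"] hues
      by (simp add: fresh_env_def)
    finally show ?thesis .
  qed
  then have "env H (trail mv k, w) = fresh_env (hue mv (Suc i))" by blast
  then have dw: "decide mv H (trail mv k, w) = mv 0 (fresh_env (hue mv (Suc i)))"
    using tr by (simp add: decide_def)
  \<comment> \<open>\<open>colour_of Stop\<close> is 0, so the nonzero hue also excludes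
    \<open>Stop\<close>.\<close>
  then obtain d where d: "decide mv H (trail mv k, w) = Move (hue mv (Suc (Suc i))) d"
    using hues(2) hue_Suc[of mv "Suc i"] by (cases "mv 0 (fresh_env (hue mv (Suc i)))") auto
  define F where "F = (trail mv k)(w := hue mv (Suc (Suc i)))"
  obtain u where u: "u \<in> nbrs H w" "trail mv k u = d"
    using decide_MoveD(1)[OF alg finite_parcs_H d] by auto
  then have u_cases: "u = i \<or> u = 2 * m + 1 \<or> u = 2 * m + 2" using nbrs_w by simp
  have "step mv H (trail mv k, w) (F, u)"
    using u stepI[OF d] by (simp add: F_def)
  then have L2: "leads mv H 0 (insert u (insert w V)) (F, u)"
    using leads.step[OF L1] by fastforce
  \<comment> \<open>The part of the graph on the near side of \<open>i + 1\<close>. The leaf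
    \<open>w + 1\<close> of \<open>i + 1\<close> lies outside.\<close>
  define Q where "Q = {v. v < N \<and> (v \<le> i \<or> m < v \<and> v \<le> w \<or> 2 * m < v)}"
  have "pverts H \<subseteq> insert u (insert w V) \<union> Q"
  proof (rule twin_trap[OF alg finite_parcs_H explores[OF connected_H bipartite_H] L2 zero_in_H])
    show "snd (F, u) \<in> Q" using u_cases le by (auto simp: Q_def N_def)
    fix a b assume a: "a \<in> Q" and b: "b \<in> nbrs H a" "b \<notin> Q"
    consider "a < i" | "a = i" | "m < a" "a \<le> w" | "2 * m < a" "a < N"
      using a by (auto simp: Q_def le_less)
    then show "\<exists>b'\<in>nbrs H a \<inter> Q. fst (F, u) b \<noteq> 0 \<and> fst (F, u) b' = fst (F, u) b"
    proof cases
      case 1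
      then have "nbrs H a = {j. a = Suc j} \<union> {a + 1, m + 1 + a}"
        using nbrs_path[of a] le by (simp add: sp)
      then have "a = Suc b \<or> b = a + 1 \<or> b = m + 1 + a" using b(1) by auto
      then show ?thesis using b(2) 1 le by (auto simp: Q_def N_def w_def)
    next
      case 2
      then have "i = Suc b \<or> b = i + 1 \<or> b = w" using b(1) nbrs_i by auto
      then have "b = i + 1" using b(2) le by (auto simp: Q_def N_def w_def)
      moreover have "F (Suc i) = hue mv (Suc (Suc i))" "F w = hue mv (Suc (Suc i))"
        using tr(2) le by (auto simp: F_def w_def)
      moreover have "w \<in> nbrs H a" using 2 nbrs_i by simp
      moreover have "w \<in> Q" using le by (simp add: Q_def w_def N_def)
      ultimately show ?thesis using hues(2) by auto
    next
      case 3
      define j where "j = a - (m + 1)"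
      have j: "j \<le> i" "a = m + 1 + j" using 3 by (auto simp: j_def w_def)
      then have "nbrs H a \<subseteq> {j} \<union> {2 * m + 1..<N}"
        using nbrs_leaf[of j] le by auto
      then have "b = j \<or> 2 * m < b \<and> b < N" using b(1) by auto
      then show ?thesis using b(2) j(1) le by (auto simp: Q_def N_def)
    next
      case 4
      then have "b = w" using b nbrs_extra[of a] by simp
      then show ?thesis using b(2) le by (auto simp: Q_def w_def N_def)
    qed
  qed
  moreover have "w + 1 \<in> pverts H" using le by (subst pverts_H) (simp add: w_def N_def)
  ultimately have "w + 1 \<in> insert u (insert w V) \<union> Q" by blast
  moreover have "w + 1 \<notin> Q" "w + 1 \<notin> V" using V(1) le by (auto simp: Q_def w_def)
  moreover have "w + 1 \<noteq> u" using u_cases le by (auto simp: w_def)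
  ultimately show False by simp
qed

text \<open>By \<open>no_stray\<close>, a coloured vertex is left towards colour 0 only if its
  successor is the uncoloured front. So the adversary can always answer on the path, and the trail
  stays as it is.\<close>

lemma inner_step:
  assumes att: "attains mv m k i" and le: "i < k" "k \<le> m" and pos: "positive k"
  shows "\<exists>i'\<le>k. always_step mv m (trail mv k, i) (trail mv k, i') \<and> attains mv m k i'"
proof -
  obtain c1 d where dec: "trail_decision mv k i = Move c1 d"
    using not_Stop[OF att] le by (cases "trail_decision mv k i") auto
  define N where "N = 2 * m + 1"
  interpret caterpillar m "{}" m N
    using le by unfold_locales (auto simp: N_def)
  have decH: "decide mv H (trail mv k, i) = Move c1 d"
    using decide_trail[OF pathlike_H, of i k mv] le dec by simp
  have tr: "trail mv k i = hue mv (Suc i)" using le by (simp add: trail_def)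
  then have c1: "c1 = hue mv (Suc i)"
    using decide_MoveD(2)[OF alg finite_parcs_H decH] pos le by simp
  obtain u where u: "u \<in> nbrs H i" "trail mv k u = d"
    using decide_MoveD(1)[OF alg finite_parcs_H decH] by auto
  have "\<exists>i'. (i = Suc i' \<or> i' = Suc i) \<and> trail mv k i' = d"
  proof (cases "u = m + 1 + i")
    case True
    then have "d = 0" using u le by (simp add: trail_def)
    then have "\<not> i + 1 < k" using no_stray[OF att _ le(2) pos] dec by blast
    then show ?thesis using \<open>d = 0\<close> by (auto simp: trail_def)
  next
    case False
    then have "i = Suc u \<or> u = Suc i"
      using u(1) nbrs_path[of i] le by (auto simp: spare_def)
    then show ?thesis using u(2) by blast
  qed
  then obtain i' where i': "i = Suc i' \<or> i' = Suc i" "trail mv k i' = d" by blast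
  have st: "always_step mv m (trail mv k, i) (trail mv k, i')"
    using always_stepI[OF dec _ _ _ i'] le by (simp add: c1)
  moreover have "i' \<le> k" using i'(1) le by auto
  ultimately show ?thesis
    using attains_step[OF att st] by auto
qed

text \<open>Otherwise the attainable positions below \<open>k\<close> are closed under the steps of
  \<open>inner_step\<close> and form an endless walk.\<close>

lemma attains_front:
  assumes att: "attains mv m k i" and le: "i < k" "k \<le> m" and pos: "positive k"
  shows "attains mv m k k"
proof (rule ccontr)
  assume no: "\<not> attains mv m k k"
  define P where "P = {i. i < k \<and> attains mv m k i}"
  have "\<exists>i'\<in>P. always_step mv (Suc m) (trail mv k, i) (trail mv k, i')" if i: "i \<in> P" for i
  proof -
    obtain i' where i': "i' \<le> k" "always_step mv m (trail mv k, i) (trail mv k, i')" "attains mv m k i'"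
      using inner_step[of m k i] i le pos by (auto simp: P_def)
    moreover have "i' \<noteq> k" using no i'(3) by blast
    ultimately have "i' \<in> P" by (simp add: P_def)
    then show ?thesis using always_step_mono[OF i'(2), of "Suc m"] by auto
  qed
  moreover have "i \<in> P" "P \<subseteq> {..k}" using att le(1) by (auto simp: P_def)
  ultimately show False
    using no_endless_walk[OF att le(2)] by blast
qed

text \<open>
  The agent leaves the uncoloured vertex \<open>k\<close> for a vertex \<open>K\<close> that is also adjacent to \<open>k - 2\<close>.
  This makes \<open>K\<close> a twin of \<open>k - 1\<close>, so it gets the same colour, and the leaf at \<open>k - 1\<close> is never
  visited.  For \<open>k = 0\<close> the agent runs back and forth between \<open>0\<close> and \<open>1\<close>.
\<close>

lemma fresh_not_skipped:
  assumes att: "attains mv k k k" and pos: "positive k"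
    and dec: "trail_decision mv k k = Move 0 0"
  shows False
proof -
  \<comment> \<open>\<open>A\<close> is the singleton of \<open>k - 2\<close>, or empty if
    \<open>k < 2\<close>, and \<open>K\<close> carries one extra leaf \<open>2 * K + 1\<close>. With
    \<open>k\<close> and that leaf uncoloured, \<open>K\<close> has the environment in which
    \<open>k - 1\<close> was coloured.\<close>
  define K A N where "K = k + 1" and "A = {j. j + 2 = k}" and "N = 2 * K + 2"
  interpret caterpillar K A K N
    by unfold_locales (auto simp: K_def A_def N_def)
  have K: "k < K" "0 < K" by (auto simp: K_def)
  have in_A: "j \<in> A \<longleftrightarrow> j + 2 = k" for j by (simp add: A_def)
  have tr_out: "\<And>v. k \<le> v \<Longrightarrow> trail mv k v = 0" by (simp add: trail_def)
  obtain V where V: "V \<subseteq> {..k}" "leads mv H 0 V (trail mv k, k)"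
    using att pathlike_H K unfolding attains_def by (meson less_or_eq_imp_le)
  have decH: "decide mv H (trail mv k, k) = Move 0 0"
    using decide_trail[OF pathlike_H, of k k mv] K dec by simp
  have nbrs_k: "nbrs H k = {i. k = Suc i} \<union> {K, K + 1 + k}"
  proof -
    have "k \<notin> A" by (simp add: A_def)
    then have "spare k = K + 1 + k" by (simp add: spare_def)
    moreover have "Suc k = K" by (simp add: K_def)
    ultimately
    show ?thesis using nbrs_path[of k] K by simp
  qed
  have nbrs_K: "nbrs H K = {k} \<union> A \<union> {2 * K + 1}"
  proof -
    have "K - 1 = k" "{2 * K + 1..<N} = {2 * K + 1}" by (auto simp: K_def N_def)
    then show ?thesis using nbrs_end[OF K(2)] by simp
  qed
  have fin: "finite (nbrs H v)" for v by (rule finite_nbrs[OF finite_parcs_H])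
  have st: "step mv H (trail mv k, k) (trail mv k, K)"
    using stepI[OF decH, of K] nbrs_k K tr_out by simp
  have L1: "leads mv H 0 (insert K V) (trail mv k, K)"
    using leads.step[OF V(2) st] by simp
  have "env H (trail mv k, K) d = fresh_env (hue mv (k - 1)) d" for d
  proof (cases "2 \<le> k")
    case True
    then have A: "A = {k - 2}" by (auto simp: A_def)
    have "nbrs H K = {k, k - 2, 2 * K + 1}" unfolding nbrs_K using A by auto
    then have e: "env H (trail mv k, K) d = (\<Sum>v\<in>{k, k - 2, 2 * K + 1}. of_bool (trail mv k v = d))"
      by (simp only: env_eq_sum[OF fin])
    have "Suc (k - 2) = k - 1" using True by simp
    then have "trail mv k (k - 2) = hue mv (k - 1)" "hue mv (k - 1) \<noteq> 0"
      using True pos[rule_format, of "k - 2"] by (auto simp: trail_def)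
    then show ?thesis unfolding e
      using True tr_out[of k] tr_out[of "2 * K + 1"] by (simp add: fresh_env_def K_def)
  next
    case False
    then have A: "A = {}" by (auto simp: A_def)
    have "nbrs H K = {k, 2 * K + 1}" unfolding nbrs_K using A by auto
    then have e: "env H (trail mv k, K) d = (\<Sum>v\<in>{k, 2 * K + 1}. of_bool (trail mv k v = d))"
      by (simp only: env_eq_sum[OF fin])
    have "k - 1 = 0" using False by simp
    then show ?thesis unfolding e
      using tr_out[of k] tr_out[of "2 * K + 1"] by (simp add: fresh_env_def K_def)
  qed
  then have "env H (trail mv k, K) = fresh_env (hue mv (k - 1))" by blast
  then have dK: "decide mv H (trail mv k, K) = mv 0 (fresh_env (hue mv (k - 1)))"
    using K by (simp add: decide_def tr_out)
  show False
  proof (cases "k = 0")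
    case True
    define I where "I s \<longleftrightarrow> s = (trail mv k, k) \<or> s = (trail mv k, K)" for s
    have dK0: "decide mv H (trail mv k, K) = Move 0 0"
      using dK dec trail_decision_fresh[of k mv] True by simp
    have "step mv H (trail mv k, K) (trail mv k, k)"
      using stepI[OF dK0, of k] nbrs_K K by (simp add: tr_out)
    then have "\<forall>s. I s \<longrightarrow> decide mv H s \<noteq> Stop \<longrightarrow> (\<exists>s'. step mv H s s' \<and> I s')"
      using st unfolding I_def by blast
    moreover have "K + 1 + k \<in> pverts H" by (subst pverts_H) (auto simp: A_def N_def K_def)
    moreover have "I (trail mv k, k)" by (simp add: I_def)
    ultimately have "K + 1 + k \<in> V \<or> (\<exists>s. I s \<and> snd s = K + 1 + k)"
      using visits(2)[OF explorer_axioms V(2), of I] by blast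
    then show False using V(1) by (auto simp: I_def K_def)
  next
    case False
    define w where "w = k - 1"
    have "k = Suc w" using False by (simp add: w_def)
    then have w: "k = Suc w" "hue mv k \<noteq> 0"
      using pos by auto
    have "hue mv k = colour_of (mv 0 (fresh_env (hue mv (k - 1))))"
      using hue_Suc[of mv w] w(1) by simp
    then obtain d where d: "decide mv H (trail mv k, K) = Move (hue mv k) d"
      using w(2) dK by (cases "mv 0 (fresh_env (hue mv (k - 1)))") auto
    define F where "F = (trail mv k)(K := hue mv k)"
    obtain u where u: "u \<in> nbrs H K" "trail mv k u = d"
      using decide_MoveD(1)[OF alg finite_parcs_H d] by auto
    then have u_cases: "u = k \<or> u + 2 = k \<or> u = 2 * K + 1" by (auto simp: nbrs_K in_A)
    have "step mv H (trail mv k, K) (F, u)"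
      using u stepI[OF d] by (simp add: F_def)
    then have L2: "leads mv H 0 (insert u (insert K V)) (F, u)"
      using leads.step[OF L1] by fastforce
    have "w \<notin> A" using w(1) by (simp_all add: A_def)
    have w_K: "w < K" using w(1) K by simp
    have nbrs_w: "nbrs H w = {i. w = Suc i} \<union> {k, K + 1 + w}"
    proof -
      have "spare w = K + 1 + w" using \<open>w \<notin> A\<close> by (simp add: spare_def)
      then show ?thesis using nbrs_path[of w] w_K w(1) by simp
    qed
    have nbrs_leaf_w: "nbrs H (K + 1 + w) = {w}"
      using nbrs_leaf[of w] K \<open>w \<notin> A\<close> w(1) w_K by simp
    have sym: "a \<in> nbrs H b" if "b \<in> nbrs H a" for a b
      using that by (auto simp: in_nbrs_H)
    \<comment> \<open>The leaf of \<open>w = k - 1\<close> can be entered only from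
      \<open>w\<close>, and the neighbours of \<open>w\<close> inside \<open>Q\<close> are
      \<open>k\<close> and, if it exists, \<open>k - 2\<close>. Both are adjacent to the twin
      \<open>K\<close>.\<close>
    define Q where "Q = - {w, K + 1 + w}"
    have "pverts H \<subseteq> insert u (insert K V) \<union> Q"
    proof (rule twin_trap[OF alg finite_parcs_H explores[OF connected_H bipartite_H] L2 zero_in_H])
      show "snd (F, u) \<in> Q" using u_cases w(1) by (auto simp: Q_def K_def)
      fix a b assume a: "a \<in> Q" and b: "b \<in> nbrs H a" "b \<notin> Q"
      have b': "b = w" using a b sym[OF b(1)] nbrs_leaf_w by (auto simp: Q_def)
      then have "a \<in> A \<or> a = k"
        using sym[OF b(1)] a unfolding b' nbrs_w by (auto simp: w(1) Q_def in_A)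
      then have "K \<in> nbrs H a"
        using nbrs_k sym[of a K] by (auto simp: nbrs_K)
      moreover have "K \<in> Q" using w(1) by (simp add: Q_def K_def)
      moreover have "F b = hue mv k" "F K = hue mv k"
        using w(1) b' K by (auto simp: F_def trail_def)
      ultimately show "\<exists>b'\<in>nbrs H a \<inter> Q. fst (F, u) b \<noteq> 0 \<and> fst (F, u) b' = fst (F, u) b"
        using w(2) by auto
    qed
    moreover have "K + 1 + w \<in> pverts H"
      using w(1) by (subst pverts_H) (auto simp: A_def N_def K_def)
    moreover have "K + 1 + w \<notin> insert u (insert K V)"
      using u_cases V(1) w(1) by (auto simp: K_def)
    ultimately show False by (auto simp: Q_def)
  qed
qed

text \<open>Leaving \<open>k\<close> uncoloured keeps the trail unchanged: going on to an uncoloured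
  vertex is excluded by \<open>fresh_not_skipped\<close>, and going back to \<open>k - 1\<close>
  yields an endless walk.\<close>

lemma fresh_coloured:
  assumes att: "attains mv k k k" and pos: "positive k"
  shows "hue mv (Suc k) \<noteq> 0"
    and "\<exists>d. trail_decision mv k k = Move (hue mv (Suc k)) d \<and> (d = 0 \<or> (\<exists>j. k = Suc j \<and> d = hue mv k))"
proof -
  have dfresh: "trail_decision mv k k = mv 0 (fresh_env (hue mv k))"
    using trail_decision_fresh[of k mv] pos by (metis Suc_pred lessI)
  obtain c1 d where dec: "trail_decision mv k k = Move c1 d"
    using not_Stop[OF att] by (cases "trail_decision mv k k") auto
  have c1: "c1 = hue mv (Suc k)" using dec dfresh by (simp add: hue_Suc)
  \<comment> \<open>A concrete graph, needed only to read off which colours can be chosen at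
    \<open>k\<close>.\<close>
  define K N where "K = Suc k" and "N = 2 * K + 1"
  interpret caterpillar K "{}" K N
    by unfold_locales (auto simp: N_def)
  have decH: "decide mv H (trail mv k, k) = Move c1 d"
    using decide_trail[OF pathlike_H, of k k mv] dec by (simp add: K_def)
  obtain u where u: "u \<in> nbrs H k" "trail mv k u = d"
    using decide_MoveD(1)[OF alg finite_parcs_H decH] by auto
  have d: "d = 0 \<or> (\<exists>j. k = Suc j \<and> d = hue mv k)"
  proof -
    have kK: "k < K" by (simp add: K_def)
    have "spare k = K + 1 + k" by (simp add: spare_def)
    then have "u \<in> {i. k = Suc i} \<union> {k + 1, K + 1 + k}"
      using u(1) nbrs_path[OF kK] by simp
    then consider "k = Suc u" | "k \<le> u" by auto
    then show ?thesis
    proof cases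
      case 1
      then show ?thesis using u(2) by (simp add: trail_def)
    next
      case 2
      then show ?thesis using u(2) by (simp add: trail_def)
    qed
  qed
  show "hue mv (Suc k) \<noteq> 0"
  proof
    assume "hue mv (Suc k) = 0"
    then have c1: "c1 = 0" using c1 by simp
    show False
    proof (cases "d = 0")
      case True
      then show False using fresh_not_skipped[OF att pos] dec c1 by simp
    next
      case False
      then obtain j where j: "k = Suc j" "d = hue mv k" using d by auto
      have retreat: "always_step mv (Suc k) (trail mv k, k) (trail mv k, j)"
        by (rule always_stepI[OF dec]) (use j c1 in \<open>auto simp: trail_def\<close>)
      have att': "attains mv (Suc k) k k"
        using att unfolding attains_def by (meson Suc_leD)
      define P where "P = {i. i \<le> k \<and> attains mv (Suc k) k i}"
      have "\<exists>i'\<in>P. always_step mv (Suc (Suc k)) (trail mv k, i) (trail mv k, i')" if i: "i \<in> P" for i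
      proof (cases "i = k")
        case True
        have "j \<in> P" using attains_step[OF att retreat] j(1) by (simp add: P_def)
        then show ?thesis using always_step_mono[OF retreat, of "Suc (Suc k)"] True by auto
      next
        case False
        then obtain i' where "i' \<le> k" "always_step mv (Suc k) (trail mv k, i) (trail mv k, i')"
          "attains mv (Suc k) k i'"
          using inner_step[of "Suc k" k i] i pos by (auto simp: P_def)
        then show ?thesis using always_step_mono[of mv "Suc k"] by (intro bexI[of _ i']) (auto simp: P_def)
      qed
      moreover have "k \<in> P" "P \<subseteq> {..k}" using att' by (auto simp: P_def)
      ultimately show False
        using no_endless_walk[OF att' _ \<open>k \<in> P\<close> \<open>P \<subseteq> {..k}\<close>] by simp
    qed
  qed
  show "\<exists>d. trail_decision mv k k = Move (hue mv (Suc k)) d \<and> (d = 0 \<or> (\<exists>j. k = Suc j \<and> d = hue mv k))"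
    using dec c1 d by blast
qed

text \<open>Having coloured \<open>k\<close>, the agent may first turn back;
  \<open>attains_front\<close> still brings it to \<open>k + 1\<close>.\<close>

lemma trail_grows: "positive k \<and> attains mv k k k"
proof (induction k)
  case 0
  have "leads mv G 0 {0} (trail mv 0, 0)" for G
  proof -
    have "trail mv 0 = (\<lambda>_. 0)" by (auto simp: trail_def)
    then show ?thesis using leads.init[of mv G 0] by simp
  qed
  then show ?case unfolding attains_def by auto
next
  case (Suc k)
  then have pos: "positive k" and att: "attains mv k k k" by auto
  note fc = fresh_coloured[OF att pos]
  have pos': "positive (Suc k)" using pos fc(1) by (simp add: less_Suc_eq)
  obtain d where d: "trail_decision mv k k = Move (hue mv (Suc k)) d"
    "d = 0 \<or> (\<exists>j. k = Suc j \<and> d = hue mv k)" using fc(2) by blast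
  have "attains mv (Suc k) (Suc k) (Suc k)"
  proof (cases "d = 0")
    case True
    have "always_step mv (Suc k) (trail mv k, k) (trail mv (Suc k), Suc k)"
      by (rule always_stepI[OF d(1)]) (use True in \<open>auto simp: trail_def\<close>)
    then show ?thesis using attains_step[OF att] by simp
  next
    case False
    then obtain j where j: "k = Suc j" "d = hue mv k" using d(2) by auto
    have "always_step mv (Suc k) (trail mv k, k) (trail mv (Suc k), j)"
      by (rule always_stepI[OF d(1)]) (use j in \<open>auto simp: trail_def\<close>)
    then have "attains mv (Suc k) (Suc k) j" using attains_step[OF att] j by simp
    then show ?thesis using attains_front[OF _ _ _ pos', of "Suc k" j] j by simp
  qed
  then show ?case using pos' by blast
qed

section \<open>Distinct colours\<close>

text \<open>The vertex \<open>K = k + 1\<close> takes the place of the leaf of \<open>i\<close>;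
  \<open>even (i + k)\<close> makes this chord admissible. Both neighbours of \<open>K\<close> have
  colour \<open>c\<close>, so the adversary may always enter \<open>i\<close> from there.\<close>

lemma same_side_distinct:
  assumes ik: "i < k" "even (i + k)" and same: "hue mv (Suc i) = hue mv (Suc k)"
  shows False
proof -
  define K A N c where "K = k + 1" and "A = {i}" and "N = 2 * K + 1" and "c = hue mv (Suc i)"
  have K: "k < K" "i < K" "0 < K" using ik by (auto simp: K_def)
  have in_A: "j \<in> A \<longleftrightarrow> j = i" for j by (simp add: A_def)
  interpret caterpillar K A K N
    using ik by unfold_locales (auto simp: in_A K_def N_def)
  obtain V where V: "V \<subseteq> {..K}" "leads mv H 0 V (trail mv K, K)"
    using trail_grows[of K] pathlike_H unfolding attains_def by blast
  have pos: "trail mv K v \<noteq> 0" if "v < K" for v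
    using that trail_grows[of K] by (simp add: trail_def)
  have tr: "trail mv K i = c" "trail mv K k = c"
    using K same by (auto simp: trail_def c_def)
  have nbrs_K: "nbrs H K = {k, i}"
  proof -
    have "{2 * K + 1..<N} = {}" "K - 1 = k" by (auto simp: N_def K_def)
    then show ?thesis using nbrs_end[OF K(3)] by (auto simp: A_def)
  qed
  have nbrs_i: "nbrs H i = {j. i = Suc j} \<union> {i + 1, K}"
    using nbrs_path[OF K(2)] by (simp add: spare_def in_A)
  have nbrs_j: "nbrs H j = {j'. j = Suc j'} \<union> {j + 1, K + 1 + j}" if "j < K" "j \<noteq> i" for j
    using nbrs_path[OF that(1)] that(2) by (simp add: spare_def in_A)
  have nbrs_spare: "nbrs H (K + 1 + j) = {j}" if "j < K" "j \<noteq> i" for j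
    using nbrs_leaf[of j] that K by (auto simp: in_A)
  have "K + 1 + k \<in> pverts H"
    using ik by (subst pverts_H) (auto simp: in_A K_def N_def)
  moreover have "K + 1 + k \<notin> V" "K + 1 + k \<noteq> i" using V(1) ik by auto
  ultimately have leaf: "K + 1 + k \<in> pverts H" "K + 1 + k \<notin> V" "K + 1 + k \<noteq> i" by blast+
  have leaf_visited: "(\<exists>s. I s \<and> snd s = K + 1 + k) \<or> K + 1 + k \<in> V'"
    if "leads mv H 0 V' s" "I s"
      "\<forall>s. I s \<longrightarrow> decide mv H s \<noteq> Stop \<longrightarrow> (\<exists>s'. step mv H s s' \<and> I s')" for I V' s
    using visits(2)[OF explorer_axioms that leaf(1)] by blast
  \<comment> \<open>The leaf \<open>K + 1 + k\<close> of \<open>k\<close> has not been visited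
    yet.\<close>
  have "decide mv H (trail mv K, K) \<noteq> Stop"
    using leaf_visited[OF V(2), of "\<lambda>s. s = (trail mv K, K)"] leaf(2) by auto
  then obtain e d0 where dK: "decide mv H (trail mv K, K) = Move e d0"
    by (cases "decide mv H (trail mv K, K)") auto
  have d0: "d0 = c"
    using decide_MoveD(1)[OF alg finite_parcs_H dK] tr by (auto simp: nbrs_K)
  \<comment> \<open>The colours once \<open>K\<close> has been left for the first time;
    \<open>e = 0\<close> is possible.\<close>
  define F where "F = (trail mv K)(K := e)"
  have F: "F i = c" "F k = c" "F K = e" "\<And>v. v < K \<Longrightarrow> F v \<noteq> 0"
    using tr K pos by (auto simp: F_def)
  have "step mv H (trail mv K, K) (F, i)"
    using stepI[OF dK, of i] tr d0 by (simp add: nbrs_K F_def)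
  then have L: "leads mv H 0 (insert i V) (F, i)"
    using leads.step[OF V(2)] by fastforce
  \<comment> \<open>Only the path is frozen, the leaves may still change. This fixes the decision at
    \<open>i\<close>, all of whose neighbours are on the path.\<close>
  define J where "J s \<longleftrightarrow> (\<forall>v\<le>K. fst s v = F v)" for s :: "nat state"
  have J_i: "decide mv H s = decide mv H (F, i)" if "J s" "snd s = i" for s
  proof -
    have "env H (fst s, i) = env H (F, i)"
      using that(1) K by (intro env_cong) (auto simp: J_def nbrs_i)
    moreover have "fst s i = F i" using that(1) K by (simp add: J_def)
    ultimately show ?thesis using that(2) by (cases s) (simp add: decide_def)
  qed
  have J_K: "c1 = e \<and> d = c" if s: "J s" "snd s = K" and dec: "decide mv H s = Move c1 d" for s c1 d
  proof -
    note D = decide_MoveD[OF alg finite_parcs_H dec]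
    have d: "d = c" using D(1) s F(1,2) K by (auto simp: nbrs_K J_def)
    have sK: "fst s K = e" using s F(3) by (simp add: J_def)
    \<comment> \<open>If \<open>K\<close> was left uncoloured, its environment is still the same and
      it is left uncoloured again; otherwise its colour is permanent.\<close>
    show ?thesis
    proof (cases "e = 0")
      case True
      have "env H (fst s, K) = env H (trail mv K, K)"
        using s(1) K by (intro env_cong) (auto simp: J_def nbrs_K F_def)
      moreover have "trail mv K K = 0" by (simp add: trail_def)
      ultimately have "decide mv H s = decide mv H (trail mv K, K)"
        using sK True s(2) by (cases s) (simp add: decide_def)
      then show ?thesis using dec dK d by simp
    next
      case False
      then show ?thesis using D(2) sK s(2) d by simp
    qed
  qed
  have J_step: "\<exists>s'. step mv H s s' \<and> J s' \<and> snd s' = w"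
    if s: "J s" and dec: "decide mv H s = Move c1 d" and w: "w \<in> nbrs H (snd s)" "fst s w = d" for s c1 d w
  proof -
    have "step mv H s ((fst s)(snd s := c1), w)"
      using stepI[of mv H "fst s" "snd s" c1 d w] dec w by simp
    moreover have "c1 = F (snd s)" if le: "snd s \<le> K"
    proof (cases "snd s = K")
      case True
      then show ?thesis using J_K[OF s _ dec] F(3) by simp
    next
      case False
      then show ?thesis
        using decide_MoveD(2)[OF alg finite_parcs_H dec] le s F(4)[of "snd s"] by (auto simp: J_def)
    qed
    then have "J ((fst s)(snd s := c1), w)" using s by (auto simp: J_def)
    ultimately show ?thesis by fastforce
  qed
  \<comment> \<open>From \<open>K\<close> the adversary answers with \<open>i\<close>, and at
    \<open>i\<close> with a path vertex in \<open>Q\<close>. Elsewhere every neighbour is in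
    \<open>Q\<close>.\<close>
  have confined: "\<forall>s. J s \<and> snd s \<in> Q \<longrightarrow> decide mv H s \<noteq> Stop \<longrightarrow>
      (\<exists>s'. step mv H s s' \<and> J s' \<and> snd s' \<in> Q)"
    if "i \<in> Q"
      and at_i: "\<And>c1 d. decide mv H (F, i) = Move c1 d \<Longrightarrow> \<exists>b\<in>nbrs H i \<inter> Q. b \<le> K \<and> F b = d"
      and closed: "\<And>a. a \<in> Q \<Longrightarrow> a \<noteq> i \<Longrightarrow> a \<noteq> K \<Longrightarrow> nbrs H a \<subseteq> Q" for Q
  proof (intro allI impI)
    fix s assume s: "J s \<and> snd s \<in> Q" and go: "decide mv H s \<noteq> Stop"
    then obtain c1 d where dec: "decide mv H s = Move c1 d" by (cases "decide mv H s") auto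
    have "\<exists>w\<in>nbrs H (snd s) \<inter> Q. fst s w = d"
    proof -
      consider "snd s = i" | "snd s = K" | "snd s \<noteq> i" "snd s \<noteq> K" by blast
      then show ?thesis
      proof cases
        case 1
        then have "decide mv H (F, i) = Move c1 d" using J_i s dec by simp
        then obtain b where "b \<in> nbrs H i \<inter> Q" "b \<le> K" "F b = d" using at_i by blast
        then show ?thesis using s 1 by (auto simp: J_def)
      next
        case 2
        then have "d = c" using J_K s dec by blast
        moreover have "fst s i = c" using s F(1) K by (simp add: J_def)
        moreover have "i \<in> nbrs H (snd s)" using 2 by (simp add: nbrs_K)
        ultimately show ?thesis using \<open>i \<in> Q\<close> by blast
      next
        case 3
        then show ?thesis
          using decide_MoveD(1)[OF alg finite_parcs_H dec] closed[of "snd s"] s by blast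
      qed
    qed
    then show "\<exists>s'. step mv H s s' \<and> J s' \<and> snd s' \<in> Q"
      using J_step[OF conjunct1[OF s] dec] by blast
  qed
  have start: "J (F, i)" by (simp add: J_def)
  show False
  \<comment> \<open>The fixed decision at \<open>i\<close> either forces the move to
    \<open>i + 1\<close> or allows the adversary to avoid \<open>i + 1\<close> for ever.\<close>
  proof (cases "\<exists>c1 d. decide mv H (F, i) = Move c1 d \<and> (\<forall>b\<in>nbrs H i. F b = d \<longrightarrow> b = i + 1)")
    case False
    \<comment> \<open>The path up to \<open>i\<close>, the leaves of vertices below
      \<open>i\<close>, and \<open>K\<close>. The leaf of \<open>k\<close> is out of reach.\<close>
    define Q where "Q = {v. v \<le> i \<or> v = K \<or> K < v \<and> v \<le> K + i}"
    have "\<forall>s. J s \<and> snd s \<in> Q \<longrightarrow> decide mv H s \<noteq> Stop \<longrightarrow>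
      (\<exists>s'. step mv H s s' \<and> J s' \<and> snd s' \<in> Q)"
    proof (rule confined)
      show "i \<in> Q" by (simp add: Q_def)
      fix c1 d assume "decide mv H (F, i) = Move c1 d"
      then obtain b where b: "b \<in> nbrs H i" "F b = d" "b \<noteq> i + 1" using False by blast
      then have "b \<in> Q" "b \<le> K" using K by (auto simp: nbrs_i Q_def)
      then show "\<exists>b\<in>nbrs H i \<inter> Q. b \<le> K \<and> F b = d" using b by blast
    next
      fix a assume a: "a \<in> Q" "a \<noteq> i" "a \<noteq> K"
      then consider "a < i" | "K < a" "a \<le> K + i" by (auto simp: Q_def)
      then show "nbrs H a \<subseteq> Q"
      proof cases
        case 1
        then have "nbrs H a = {j'. a = Suc j'} \<union> {a + 1, K + 1 + a}"
          using nbrs_j K by simp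
        moreover have "b \<in> Q" if "a = Suc b \<or> b = a + 1 \<or> b = K + 1 + a" for b
          using that 1 K(2) by (auto simp: Q_def)
        ultimately show ?thesis by blast
      next
        case 2
        define j where "j = a - (K + 1)"
        have "a = K + 1 + j" "j < i" using 2 by (auto simp: j_def)
        then have "nbrs H a = {j}" "j \<in> Q" using nbrs_spare K by (simp_all add: Q_def)
        then show ?thesis by simp
      qed
    qed
    moreover have "J (F, i) \<and> snd (F, i) \<in> Q" using start by (simp add: Q_def)
    ultimately have "(\<exists>s. (J s \<and> snd s \<in> Q) \<and> snd s = K + 1 + k) \<or> K + 1 + k \<in> insert i V"
      using leaf_visited[OF L, of "\<lambda>s. J s \<and> snd s \<in> Q"] by simp
    then show False using leaf(2,3) ik by (auto simp: Q_def)
  next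
    case True
    then obtain c1 d where dec: "decide mv H (F, i) = Move c1 d"
      and only: "\<And>b. b \<in> nbrs H i \<Longrightarrow> F b = d \<Longrightarrow> b = i + 1" by blast
    \<comment> \<open>The path from \<open>i\<close> on and the leaves of later vertices. The start
      0 is out of reach unless \<open>i = 0\<close>, where the agent never stops because the
      decision at \<open>i\<close> is a fixed \<open>Move\<close>.\<close>
    define Q where "Q = {v. i \<le> v \<and> v \<le> K \<or> K + 1 + i < v \<and> v \<le> 2 * K}"
    have "\<forall>s. J s \<and> snd s \<in> Q \<longrightarrow> decide mv H s \<noteq> Stop \<longrightarrow>
      (\<exists>s'. step mv H s s' \<and> J s' \<and> snd s' \<in> Q)"
    proof (rule confined)
      show "i \<in> Q" using K by (simp add: Q_def)
      fix c1' d' assume "decide mv H (F, i) = Move c1' d'"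
      then have "d' = d" using dec by simp
      moreover obtain b where b: "b \<in> nbrs H i" "F b = d"
        using decide_MoveD(1)[OF alg finite_parcs_H dec] by auto
      moreover have "b \<in> Q" "b \<le> K" using only[OF b] K by (auto simp: Q_def)
      ultimately show "\<exists>b\<in>nbrs H i \<inter> Q. b \<le> K \<and> F b = d'" by blast
    next
      fix a assume a: "a \<in> Q" "a \<noteq> i" "a \<noteq> K"
      then consider "i < a" "a < K" | "K + 1 + i < a" "a \<le> 2 * K" by (auto simp: Q_def)
      then show "nbrs H a \<subseteq> Q"
      proof cases
        case 1
        then have "nbrs H a = {j'. a = Suc j'} \<union> {a + 1, K + 1 + a}"
          using nbrs_j K by simp
        moreover have "b \<in> Q" if "a = Suc b \<or> b = a + 1 \<or> b = K + 1 + a" for b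
          using that 1 K(2) by (auto simp: Q_def)
        ultimately show ?thesis by blast
      next
        case 2
        define j where "j = a - (K + 1)"
        have "a = K + 1 + j" "i < j" "j < K" using 2 by (auto simp: j_def)
        then have "nbrs H a = {j}" "j \<in> Q" using nbrs_spare K by (simp_all add: Q_def)
        then show ?thesis by simp
      qed
    qed
    moreover have "J (F, i) \<and> snd (F, i) \<in> Q" using start K by (simp add: Q_def)
    ultimately obtain s where s: "J s" "snd s \<in> Q" "snd s = 0" "decide mv H s = Stop"
      using visits(1)[OF explorer_axioms L, of "\<lambda>s. J s \<and> snd s \<in> Q"] by blast
    then have "snd s = i" by (auto simp: Q_def)
    then show False using J_i[OF s(1)] s(4) dec by simp
  qed
qed

lemma inj_hue: "inj (\<lambda>j. hue mv (Suc j))"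
proof -
  have distinct: "hue mv (Suc i) \<noteq> hue mv (Suc k)" if "i < k" for i k
  proof
    assume same: "hue mv (Suc i) = hue mv (Suc k)"
    \<comment> \<open>The next repetition, one period beyond \<open>k\<close>. Its distance
      \<open>2 * (k - i)\<close> from \<open>i\<close> is even whatever the parity of
      \<open>k - i\<close>.\<close>
    define l where "l = k + (k - i)"
    have "hue mv (Suc i + (k - i)) = hue mv (Suc k + (k - i))"
      using same by (rule hue_shift)
    then have "hue mv (Suc i) = hue mv (Suc l)" using same that by (simp add: l_def)
    moreover have "i < l" "even (i + l)" using that by (auto simp: l_def)
    ultimately show False by (rule same_side_distinct[rotated 2])
  qed
  show ?thesis
    by (rule linorder_injI) (use distinct in blast)
qed

end

section \<open>The fan and the count of colours\<close>

definition fan :: "nat \<Rightarrow> nat pair_pre_digraph" where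
  "fan n = \<lparr>pverts = {..<n},
     parcs = {(a, b). a < n \<and> b < n \<and> a \<noteq> b \<and> (a = Suc b \<or> b = Suc a \<or> a = n - 1 \<or> b = n - 1)}\<rparr>"

lemma finite_parcs_fan: "finite (parcs (fan n))"
  by (rule finite_subset[of _ "{..<n} \<times> {..<n}"]) (auto simp: fan_def)

lemma connected_fan:
  assumes "n \<ge> 1"
  shows "connected_graph (fan n)"
proof (rule connected_graphI)
  fix v assume "v \<in> pverts (fan n)" "v \<noteq> 0"
  then show "\<exists>u<v. (v, u) \<in> parcs (fan n)"
    by (intro exI[of _ "v - 1"]) (auto simp: fan_def)
qed (use assms in \<open>auto simp: fan_def sym_def\<close>)

text \<open>The apex \<open>n - 1\<close> serves as the spare neighbour of all path vertices, so no
  vertices are spent on leaves. The path vertex \<open>n - 2\<close> has no successor besides the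
  apex, hence the length \<open>n - 2\<close>.\<close>

lemma pathlike_fan:
  assumes "n \<ge> 1"
  shows "pathlike (fan n) (\<lambda>_. n - 1) (n - 2)"
proof -
  have "nbrs (fan n) j = {i. j = Suc i} \<union> {j + 1, n - 1}" if "j < n - 2" for j
    using that by (auto simp: nbrs_def fan_def)
  then show ?thesis
    using assms finite_parcs_fan by (auto simp: pathlike_def fan_def)
qed

theorem theorem7:
  shows "\<not> (\<exists>(mv :: algorithm) (n :: nat). is_algorithm mv \<and> n \<ge> 1 \<and>
           (\<forall>G :: nat pair_pre_digraph. connected_graph G \<and> bipartite G \<longrightarrow> explores mv G) \<and>
           (\<forall>G :: nat pair_pre_digraph. connected_graph G \<and> card (pverts G) = n \<longrightarrow>
              uses_fewer_colors mv G (int n - 2)))"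
proof
  assume "\<exists>(mv :: algorithm) (n :: nat). is_algorithm mv \<and> n \<ge> 1 \<and>
           (\<forall>G :: nat pair_pre_digraph. connected_graph G \<and> bipartite G \<longrightarrow> explores mv G) \<and>
           (\<forall>G :: nat pair_pre_digraph. connected_graph G \<and> card (pverts G) = n \<longrightarrow>
              uses_fewer_colors mv G (int n - 2))"
  then obtain mv n where alg: "is_algorithm mv" and n: "n \<ge> 1"
    and expl: "\<And>G :: nat pair_pre_digraph. connected_graph G \<Longrightarrow> bipartite G \<Longrightarrow> explores mv G"
    and few: "\<And>G :: nat pair_pre_digraph. connected_graph G \<Longrightarrow> card (pverts G) = n \<Longrightarrow>
      uses_fewer_colors mv G (int n - 2)" by blast
  interpret explorer mv by unfold_locales (use alg expl in auto)
  \<comment> \<open>For \<open>n = 1\<close> the subtraction is truncated to 0, but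
    \<open>0 < int n - 2\<close> is false there as well.\<close>
  define K G where "K = n - 2" and "G = fan n"
  have path: "pathlike G (\<lambda>_. n - 1) K" using pathlike_fan[OF n] by (simp add: G_def K_def)
  then obtain V where V: "V \<subseteq> {..K}" "leads mv G 0 V (trail mv K, K)"
    using trail_grows[of K] unfolding attains_def by blast
  have zero: "0 \<in> pverts G" and fin: "finite (parcs G)" using path by (auto simp: pathlike_def)
  \<comment> \<open>The fan need not be bipartite, so exploration of it is not assumed. Any
    continuation of the walk will do, since the colours of the trail are already assigned.\<close>
  define I where "I s \<longleftrightarrow> True" for s :: "nat state"
  have "\<exists>s'. step mv G s s' \<and> I s'" if go: "decide mv G s \<noteq> Stop" for s
  proof -
    obtain c1 d where dec: "decide mv G s = Move c1 d"
      using go by (cases "decide mv G s") auto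
    obtain w where "w \<in> nbrs G (snd s)" "fst s w = d"
      using decide_MoveD(1)[OF alg fin dec] by blast
    then show ?thesis
      using stepI[of mv G "fst s" "snd s" c1 d w] dec by (auto simp: I_def)
  qed
  then have "\<exists>r n. is_run mv G r \<and> r 0 = (\<lambda>_. 0, 0) \<and> r n = (trail mv K, K) \<and>
      V = (\<lambda>t. snd (r t)) ` {..n} \<and> (\<forall>t<n. decide mv G (r t) \<noteq> Stop) \<and> (\<forall>t\<ge>n. I (r t))"
    using run_through[OF V(2) zero, of I] by (simp add: I_def)
  then obtain r t where r: "is_run mv G r" "r t = (trail mv K, K)" by blast
  let ?C = "(\<lambda>j. hue mv (Suc j)) ` {..<K}"
  have "?C \<subseteq> colors_used mv G r"
  proof
    fix x assume "x \<in> ?C"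
    then obtain j where j: "j < K" "x = hue mv (Suc j)" by blast
    then have "fst (r t) j = x" "x \<noteq> 0"
      using r(2) trail_grows[of K] by (auto simp: trail_def)
    then show "x \<in> colors_used mv G r" using color_used[OF r(1), of t j] by simp
  qed
  moreover have "card ?C = K"
    using inj_hue by (simp add: card_image inj_on_subset)
  moreover have "finite (colors_used mv G r)" "int (card (colors_used mv G r)) < int n - 2"
    using few[of G] connected_fan[OF n] r(1) by (auto simp: uses_fewer_colors_def G_def fan_def)
  ultimately have "int K < int n - 2" by (metis card_mono le_less_trans of_nat_le_iff)
  then show False using n by (simp add: K_def)
qed

end
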